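(* Let $0^{s_1}1^{t_1}\cdots0^{s_k}1^{t_k}$ be the binary string of a connected threshold graph $\Gamma$ on $n$ vertices. Then $$\det(\mathcal{A})=\begin{cases}\dfrac{(-1)^t\,t_1t_2\cdots t_k}{\prod_{i=1}^{k}(t-T_{i-1})\;\prod_{i=1}^k (t+S_i-1)^{t_i}}, & \text{if } s_i=1 \text{ for all } i,\\[10pt] 0,&\text{otherwise.}\end{cases}$$
   Context: Binary strings: a threshold graph with binary string $b=b_1\ldots b_n$ (where $b_1=0$) is the simple graph on vertices $1,\dots,n$ built by adding vertices in order, vertex $i\ge 2$ being added as an isolated vertex if $b_i=0$ and as a dominating vertex (adjacent to all earlier vertices) if $b_i=1$. A connected threshold graph on $n\ge 2$ vertices has $b_n=1$, and its string is written $0^{s_1}1^{t_1}\cdots0^{s_k}1^{t_k}$ with $k\ge1$ and all $s_i,t_i$ positive integers. Put $t=\sum_i t_i$, $S_i=\sum_{j\le i}s_j$, $T_i=\sum_{j\le i}t_j$, $T_0=0$. In particular $t-T_{k-1}=t_k$ and $t+S_k-1=n-1$. The normalized adjacency matrix of $\Gamma$ is $\mathcal{A}=D^{-1}A$, where $A$ is the adjacency matrix and $D$ the diagonal matrix of vertex degrees. *)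

theory Defs
  imports
    "Graph_Theory.Graph_Theory"
    "Jordan_Normal_Form.Determinant"
    "Jordan_Normal_Form.Gauss_Jordan_Elimination"
begin

text \<open>
  Simple graphs are represented as in the AFP entry on graph theory: an undirected edge
  is a pair of opposite arcs (locale \<^locale>\<open>pair_graph\<close>).
\<close>

definition add_isolated :: "'a \<Rightarrow> 'a pair_pre_digraph \<Rightarrow> 'a pair_pre_digraph" where
  "add_isolated v G = \<lparr> pverts = insert v (pverts G), parcs = parcs G \<rparr>"

definition add_dominating :: "'a \<Rightarrow> 'a pair_pre_digraph \<Rightarrow> 'a pair_pre_digraph" where
  "add_dominating v G =
     \<lparr> pverts = insert v (pverts G),
       parcs = parcs G \<union> pverts G \<times> {v} \<union> {v} \<times> pverts G \<rparr>"

text \<open>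
  Binary strings are lists of booleans, the bit 0 being \<^const>\<open>False\<close> and the bit 1 being
  \<^const>\<open>True\<close>. The vertices are numbered from 1, so the bit of vertex \<^term>\<open>i\<close> is at list
  position \<^term>\<open>i - 1\<close>.
\<close>

inductive threshold_graph :: "bool list \<Rightarrow> nat pair_pre_digraph \<Rightarrow> bool" where
  single: "threshold_graph [False] \<lparr> pverts = {1}, parcs = {} \<rparr>"
| isolated: "threshold_graph b G \<Longrightarrow>
    threshold_graph (b @ [False]) (add_isolated (length b + 1) G)"
| dominating: "threshold_graph b G \<Longrightarrow>
    threshold_graph (b @ [True]) (add_dominating (length b + 1) G)"

text \<open>The string \<open>0^(s 1) 1^(t 1) ... 0^(s k) 1^(t k)\<close>.\<close>

definition block_string :: "nat \<Rightarrow> (nat \<Rightarrow> nat) \<Rightarrow> (nat \<Rightarrow> nat) \<Rightarrow> bool list" where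
  "block_string k s t =
     concat (map (\<lambda>i. replicate (s i) False @ replicate (t i) True) [1..<k + 1])"

text \<open>
  Matrices of a graph on the vertices \<open>1, ..., n\<close>; matrix indices start at 0, hence the shift.
  For symmetric graphs the out-degree is the degree.
\<close>

definition adjacency_matrix :: "nat \<Rightarrow> nat pair_pre_digraph \<Rightarrow> real mat" where
  "adjacency_matrix n G = mat n n (\<lambda>(i, j). if (i + 1, j + 1) \<in> parcs G then 1 else 0)"

definition degree_matrix :: "nat \<Rightarrow> nat pair_pre_digraph \<Rightarrow> real mat" where
  "degree_matrix n G = mat_diag n (\<lambda>i. real (out_degree (with_proj G) (i + 1)))"

text \<open>Only meaningful if the degree matrix is invertible, i.e. there are no isolated vertices.\<close>

definition normalized_adjacency_matrix :: "nat \<Rightarrow> nat pair_pre_digraph \<Rightarrow> real mat" where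
  "normalized_adjacency_matrix n G = the (mat_inverse (degree_matrix n G)) * adjacency_matrix n G"

lemma threshold_graph_pverts:
  "threshold_graph b G \<Longrightarrow> pverts G = {1..length b}"
  by (induction rule: threshold_graph.induct) (auto simp: add_isolated_def add_dominating_def)

lemma threshold_graph_pair_graph:
  "threshold_graph b G \<Longrightarrow> pair_graph G"
proof (induction rule: threshold_graph.induct)
  case single
  show ?case by unfold_locales (auto simp: symmetric_def sym_def)
next
  case (isolated b G)
  interpret pair_graph G by fact
  have "sym (parcs G)" using pair_sym_arcs by (simp add: symmetric_def)
  then show ?case
    by unfold_locales
      (auto simp: add_isolated_def symmetric_def dest: in_arcsD1 in_arcsD2 pair_no_loops)
next
  case (dominating b G)
  interpret pair_graph G by fact
  have "sym (parcs G)" using pair_sym_arcs by (simp add: symmetric_def)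
  then show ?case
    using threshold_graph_pverts[OF dominating.hyps]
    by unfold_locales
      (auto simp: add_dominating_def symmetric_def sym_def
        dest: in_arcsD1 in_arcsD2 pair_no_loops)
qed

lemma threshold_graph_exists:
  "\<exists>G. threshold_graph (False # b) G"
proof (induction b rule: rev_induct)
  case Nil
  show ?case using threshold_graph.single by blast
next
  case (snoc x b)
  then obtain G where "threshold_graph (False # b) G" by blast
  then show ?case
    using threshold_graph.isolated threshold_graph.dominating by (cases x) fastforce+
qed

lemma threshold_graph_connected:
  assumes "threshold_graph (b @ [True]) G"
  shows "connected (with_proj G)"
proof -
  from assms obtain H where G: "G = add_dominating (length b + 1) H"
    by (cases rule: threshold_graph.cases) auto
  let ?v = "length b + 1"
  let ?M = "mk_symmetric (with_proj G)"
  interpret G: pair_graph G using threshold_graph_pair_graph[OF assms] .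
  have V: "pverts ?M = insert ?v (pverts H)"
    by (simp add: G mk_symmetric_def add_dominating_def)
  have arcs: "(u, ?v) \<in> parcs ?M \<and> (?v, u) \<in> parcs ?M" if "u \<in> pverts H" for u
    using that by (auto simp: G mk_symmetric_def add_dominating_def)
  interpret M: pair_wf_digraph ?M
    by (rule pair_wf_digraph.intro)
      (auto simp: mk_symmetric_def dest: G.in_arcsD1 G.in_arcsD2)
  have into: "u \<rightarrow>\<^sup>*\<^bsub>with_proj ?M\<^esub> ?v" if "u \<in> pverts ?M" for u
    using that arcs[of u] V by (cases "u = ?v") (auto intro: M.reachable_adjI)
  have out: "?v \<rightarrow>\<^sup>*\<^bsub>with_proj ?M\<^esub> u" if "u \<in> pverts ?M" for u
    using that arcs[of u] V by (cases "u = ?v") (auto intro: M.reachable_adjI)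
  show ?thesis
    unfolding connected_def strongly_connected_def
    using V into out by (auto intro: M.reachable_trans)
qed

end

theory Submission
  imports Defs
begin

text \<open>
  Since \<open>det (D\<^sup>-\<^sup>1 A) = det A / det D\<close>, the two determinants can be computed separately.
  Both are found by reading the binary string from left to right, because the graph of a
  prefix is an induced subgraph.

  For \<open>A\<close>, write \<open>d b\<close> for the determinant of the adjacency matrix of the string \<open>b\<close>. The entry
  at \<open>(i, j)\<close> is the bit of the later of the two vertices, so the last two rows of the matrix of
  \<open>b11\<close> differ only in their last two entries. Subtracting one row, and the corresponding
  column, from the other leaves a corner in which a single off-diagonal entry links the last
  vertex to the rest; expansion gives \<open>d (b11) = - 2 d (b1) - d b\<close>. In the same way
  \<open>d (b01) = - d b\<close>, while \<open>d (b0) = 0\<close> because an isolated vertex has a zero row. This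
  recurrence has the solution \<open>d (b 0 1\<^sup>m) = (-1)\<^sup>m m d b\<close> (lemma
  \<open>det_string_matrix_False_Trues\<close>). Hence each block \<open>01\<^sup>m\<close> contributes the factor \<open>(-1)\<^sup>m m\<close>,
  and a block with two or more zeros leaves, once the last zero and the ones are split off, a
  string that ends in 0 and so makes the determinant vanish.

  For \<open>D\<close>, an appended 1 raises every earlier degree by one, so the right quantity to follow along
  the string is the product of the shifted degrees \<open>deg v + c\<close> for an arbitrary \<open>c\<close> (lemma
  \<open>degree_product_block_string\<close>). At \<open>c = 0\<close> it is \<open>det D\<close>: a vertex of the \<open>i\<close>-th block of zeros
  is adjacent to exactly the \<open>t - T\<^sub>i\<^sub>-\<^sub>1\<close> later dominating vertices, and a vertex of the \<open>i\<close>-th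
  block of ones to all vertices but itself and the zeros of later blocks, which are
  \<open>t + S\<^sub>i - 1\<close>. All of these numbers are positive, so \<open>D\<close> is invertible; and when all \<open>s\<^sub>i\<close> are 1,
  the quotient is the stated formula.
\<close>

section \<open>Determinants whose last row or column is almost zero\<close>

lemma det_last_column:
  fixes A :: "'a::comm_ring_1 mat"
  assumes A: "A \<in> carrier_mat (Suc n) (Suc n)"
    and zero: "\<And>i. i < n \<Longrightarrow> A $$ (i, n) = 0"
  shows "det A = A $$ (n, n) * det (mat n n (\<lambda>ij. A $$ ij))"
proof -
  have "det A = (\<Sum>i<Suc n. A $$ (i, n) * cofactor A i n)"
    by (rule laplace_expansion_column[OF A]) simp
  also have "\<dots> = A $$ (n, n) * cofactor A n n"
    using zero by simp
  also have "mat_delete A n n = mat n n (\<lambda>ij. A $$ ij)"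
    using A by (intro eq_matI) (auto simp: mat_delete_def)
  then have "cofactor A n n = det (mat n n (\<lambda>ij. A $$ ij))"
    by (simp add: cofactor_def)
  finally show ?thesis .
qed

text \<open>
  The three-term recurrence for continuants, which requires the tridiagonal shape only in the
  last row and column: the leading block is arbitrary.
\<close>

lemma det_tridiagonal_corner:
  fixes A :: "'a::comm_ring_1 mat"
  assumes A: "A \<in> carrier_mat (Suc (Suc n)) (Suc (Suc n))"
    and row: "\<And>j. j < n \<Longrightarrow> A $$ (Suc n, j) = 0"
    and col: "\<And>i. i < n \<Longrightarrow> A $$ (i, Suc n) = 0"
  shows "det A = A $$ (Suc n, Suc n) * det (mat (Suc n) (Suc n) (\<lambda>ij. A $$ ij))
               - A $$ (Suc n, n) * A $$ (n, Suc n) * det (mat n n (\<lambda>ij. A $$ ij))"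
proof -
  define C where "C = mat_delete A (Suc n) n"
  have C: "C \<in> carrier_mat (Suc n) (Suc n)"
    using A by (auto simp: C_def mat_delete_def)
  have entry: "C $$ (i, j) = A $$ (i, if j < n then j else Suc j)"
    if "i < Suc n" "j < Suc n" for i j
    using that A by (auto simp: C_def mat_delete_def)
  have "det C = C $$ (n, n) * det (mat n n (\<lambda>ij. C $$ ij))"
    by (rule det_last_column[OF C]) (simp add: entry col)
  also have "mat n n (\<lambda>ij. C $$ ij) = mat n n (\<lambda>ij. A $$ ij)"
    by (intro eq_matI) (auto simp: entry)
  finally have det_C: "det C = A $$ (n, Suc n) * det (mat n n (\<lambda>ij. A $$ ij))"
    by (simp add: entry)
  have B: "mat_delete A (Suc n) (Suc n) = mat (Suc n) (Suc n) (\<lambda>ij. A $$ ij)"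
    using A by (intro eq_matI) (auto simp: mat_delete_def)
  have "det A = (\<Sum>j<Suc (Suc n). A $$ (Suc n, j) * cofactor A (Suc n) j)"
    by (rule laplace_expansion_row[OF A]) simp
  also have "\<dots> = A $$ (Suc n, n) * cofactor A (Suc n) n
                + A $$ (Suc n, Suc n) * cofactor A (Suc n) (Suc n)"
    using row by simp
  finally show ?thesis
    by (simp add: cofactor_def B det_C flip: C_def)
qed

section \<open>The adjacency determinant of a binary string\<close>

text \<open>
  The adjacency matrix read off the string. It makes sense for every string, including the empty
  one with determinant 1, which is the start of the recurrence below.
\<close>

definition string_matrix :: "bool list \<Rightarrow> real mat" where
  "string_matrix b =
     mat (length b) (length b) (\<lambda>(i, j). if i \<noteq> j \<and> b ! max i j then 1 else 0)"

lemma string_matrix_carrier [simp]: "string_matrix b \<in> carrier_mat (length b) (length b)"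
  and string_matrix_dim [simp]: "dim_row (string_matrix b) = length b"
    "dim_col (string_matrix b) = length b"
  by (simp_all add: string_matrix_def)

lemma string_matrix_prefix:
  "mat (length b) (length b) (\<lambda>ij. string_matrix (b @ c) $$ ij) = string_matrix b"
  by (intro eq_matI) (auto simp: string_matrix_def nth_append max_def)

lemma det_string_matrix_snoc_False: "det (string_matrix (b @ [False])) = 0"
proof -
  have "det (string_matrix (b @ [False])) = string_matrix (b @ [False]) $$ (length b, length b)
    * det (mat (length b) (length b) (\<lambda>ij. string_matrix (b @ [False]) $$ ij))"
    by (rule det_last_column) (auto simp: string_matrix_def nth_append max_def)
  then show ?thesis by (simp add: string_matrix_def)
qed

text \<open>
  The isolated vertex before the last one is adjacent only to the last one. Expanding along its
  row and column therefore removes both vertices.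
\<close>

lemma det_string_matrix_False_True:
  "det (string_matrix (b @ [False, True])) = - det (string_matrix b)"
proof -
  define n where "n = length b"
  define A where "A = string_matrix (b @ [False, True])"
  have A: "A \<in> carrier_mat (Suc (Suc n)) (Suc (Suc n))"
    by (simp add: A_def n_def carrier_matI)
  have entry: "A $$ (i, j) = (if i \<noteq> j \<and> (b @ [False, True]) ! max i j then 1 else 0)"
    if "i < Suc (Suc n)" "j < Suc (Suc n)" for i j
    using that by (simp add: A_def string_matrix_def n_def)
  define C where "C = mat_delete A n (Suc n)"
  have C: "C \<in> carrier_mat (Suc n) (Suc n)"
    using A by (auto simp: C_def mat_delete_def)
  have C_entry: "C $$ (i, j) = A $$ (if i < n then i else Suc i, j)"
    if "i < Suc n" "j < Suc n" for i j
    using that A by (auto simp: C_def mat_delete_def)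
  have "det C = C $$ (n, n) * det (mat n n (\<lambda>ij. C $$ ij))"
    by (rule det_last_column[OF C]) (simp add: C_entry entry nth_append n_def max_def)
  also have "mat n n (\<lambda>ij. C $$ ij) = mat n n (\<lambda>ij. A $$ ij)"
    by (intro eq_matI) (auto simp: C_entry)
  also have "\<dots> = string_matrix b"
    unfolding A_def n_def by (rule string_matrix_prefix)
  finally have det_C: "det C = det (string_matrix b)"
    by (simp add: C_entry entry nth_append n_def)
  have "det A = (\<Sum>j<Suc (Suc n). A $$ (n, j) * cofactor A n j)"
    by (rule laplace_expansion_row[OF A]) simp
  also have "\<dots> = cofactor A n (Suc n)"
    by (simp add: entry nth_append n_def max_def)
  also have "\<dots> = - det (string_matrix b)"
    by (simp add: cofactor_def det_C flip: C_def)
  finally show ?thesis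
    by (simp add: A_def)
qed

text \<open>
  Two consecutive dominating vertices have the same neighbours apart from each other. Subtracting
  the first from the second, in rows and in columns, preserves the determinant and turns the
  matrix into one with a tridiagonal corner.
\<close>

lemma det_string_matrix_True_True:
  "det (string_matrix (b @ [True, True]))
     = - 2 * det (string_matrix (b @ [True])) - det (string_matrix b)"
proof -
  define n where "n = length b"
  define A where "A = string_matrix (b @ [True, True])"
  have A: "A \<in> carrier_mat (Suc (Suc n)) (Suc (Suc n))"
    by (simp add: A_def n_def carrier_matI)
  have entry: "A $$ (i, j) = (if i \<noteq> j \<and> (b @ [True, True]) ! max i j then 1 else 0)"
    if "i < Suc (Suc n)" "j < Suc (Suc n)" for i j
    using that by (simp add: A_def string_matrix_def n_def)
  define B where "B = addrow (- 1) (Suc n) n A"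
  define C where "C = addcol (- 1) (Suc n) n B"
  have B: "B \<in> carrier_mat (Suc (Suc n)) (Suc (Suc n))"
    unfolding B_def using A by (intro carrier_matI) auto
  have C: "C \<in> carrier_mat (Suc (Suc n)) (Suc (Suc n))"
    unfolding C_def using B by (intro carrier_matI) auto
  have B_entry: "B $$ (i, j) = (if i = Suc n then A $$ (i, j) - A $$ (n, j) else A $$ (i, j))"
    if "i < Suc (Suc n)" "j < Suc (Suc n)" for i j
    unfolding B_def using that A by (subst index_mat_addrow(1)) auto
  have C_entry: "C $$ (i, j) = (if j = Suc n then B $$ (i, j) - B $$ (i, n) else B $$ (i, j))"
    if "i < Suc (Suc n)" "j < Suc (Suc n)" for i j
    unfolding C_def using that B by (subst index_mat_addcol(1)) auto
  \<comment> \<open>The last row of \<open>C\<close> is \<open>(0, ..., 0, 1, - 2)\<close>, and its last column is the same.\<close>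
  have "det A = det B"
    unfolding B_def by (rule det_addrow[symmetric, OF _ _ A]) auto
  also have "\<dots> = det C"
    unfolding C_def by (rule det_addcol[symmetric, OF _ _ B]) auto
  also have "\<dots> = C $$ (Suc n, Suc n) * det (mat (Suc n) (Suc n) (\<lambda>ij. C $$ ij))
               - C $$ (Suc n, n) * C $$ (n, Suc n) * det (mat n n (\<lambda>ij. C $$ ij))"
    by (rule det_tridiagonal_corner[OF C])
      (simp_all add: C_entry B_entry entry nth_append n_def max_def)
  also have "mat (Suc n) (Suc n) (\<lambda>ij. C $$ ij) = string_matrix (b @ [True])"
    using string_matrix_prefix[of "b @ [True]" "[True]"]
    by (subst (asm) eq_commute) (auto intro!: eq_matI simp: C_entry B_entry A_def n_def)
  also have "mat n n (\<lambda>ij. C $$ ij) = string_matrix b"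
    using string_matrix_prefix[of b "[True, True]"]
    by (subst (asm) eq_commute) (auto intro!: eq_matI simp: C_entry B_entry A_def n_def)
  also have "C $$ (Suc n, Suc n) = - 2"
    by (simp add: C_entry B_entry entry nth_append n_def max_def)
  also have "C $$ (Suc n, n) = 1"
    by (simp add: C_entry B_entry entry nth_append n_def max_def)
  also have "C $$ (n, Suc n) = 1"
    by (simp add: C_entry B_entry entry nth_append n_def max_def)
  finally show ?thesis
    by (simp add: A_def)
qed

text \<open>
  The recurrence \<open>x\<^sub>m\<^sub>+\<^sub>2 = - 2 x\<^sub>m\<^sub>+\<^sub>1 - x\<^sub>m\<close> has the double characteristic root \<open>- 1\<close>, and the values
  \<open>x\<^sub>0 = 0\<close> and \<open>x\<^sub>1 = - det (string_matrix b)\<close> single out this multiple of \<open>(-1)\<^sup>m m\<close>.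
\<close>

lemma det_string_matrix_False_Trues:
  "det (string_matrix (b @ False # replicate m True)) = (-1) ^ m * real m * det (string_matrix b)"
proof (induction m rule: induct_nat_012)
  case 0
  show ?case by (simp add: det_string_matrix_snoc_False)
next
  case 1
  show ?case by (simp add: det_string_matrix_False_True)
next
  case (ge2 m)
  have "b @ False # replicate (Suc (Suc m)) True = (b @ False # replicate m True) @ [True, True]"
    and "b @ False # replicate (Suc m) True = (b @ False # replicate m True) @ [True]"
    by (simp_all add: replicate_append_same[symmetric])
  then have "det (string_matrix (b @ False # replicate (Suc (Suc m)) True))
      = - 2 * det (string_matrix (b @ False # replicate (Suc m) True))
        - det (string_matrix (b @ False # replicate m True))"
    by (simp only: det_string_matrix_True_True)
  then show ?case
    by (simp only: ge2) (simp add: algebra_simps)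
qed

lemma block_string_0 [simp]: "block_string 0 s t = []"
  by (simp add: block_string_def)

lemma block_string_Suc:
  "block_string (Suc k) s t =
     block_string k s t @ replicate (s (Suc k)) False @ replicate (t (Suc k)) True"
  by (simp add: block_string_def)

lemma length_block_string:
  "length (block_string k s t) = (\<Sum>i=1..k. s i) + (\<Sum>i=1..k. t i)"
  by (induction k) (simp_all add: block_string_Suc)

text \<open>
  Only the last zero of a block is absorbed by the ones that follow it. What remains is the string
  of the preceding blocks if that zero was the only one, and otherwise a string that ends in 0.
\<close>

lemma det_string_matrix_block_string:
  assumes "\<And>i. i \<in> {1..k} \<Longrightarrow> s i > 0"
  shows "det (string_matrix (block_string k s t)) =
    (if \<forall>i\<in>{1..k}. s i = 1 then (-1) ^ (\<Sum>i=1..k. t i) * (\<Prod>i=1..k. real (t i)) else 0)"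
  using assms
proof (induction k)
  case 0
  have "string_matrix [] \<in> carrier_mat 0 0" by (simp add: string_matrix_def)
  then show ?case by simp
next
  case (Suc k)
  obtain r where r: "s (Suc k) = Suc r"
    using Suc.prems[of "Suc k"] gr0_conv_Suc by auto
  have "block_string (Suc k) s t =
      (block_string k s t @ replicate r False) @ False # replicate (t (Suc k)) True"
    by (simp add: block_string_Suc r replicate_app_Cons_same)
  then have det: "det (string_matrix (block_string (Suc k) s t)) =
      (-1) ^ t (Suc k) * real (t (Suc k)) * det (string_matrix (block_string k s t @ replicate r False))"
    by (simp only: det_string_matrix_False_Trues)
  show ?case
  proof (cases r)
    case 0
    with Suc r show ?thesis
      by (auto simp: det power_add atLeastAtMostSuc_conv)
  next
    case (Suc q)
    have "block_string k s t @ replicate r False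
        = (block_string k s t @ replicate q False) @ [False]"
      by (simp add: Suc replicate_append_same)
    then have "det (string_matrix (block_string k s t @ replicate r False)) = 0"
      by (simp only: det_string_matrix_snoc_False)
    moreover have "\<not> (\<forall>i\<in>{1..Suc k}. s i = 1)"
      using r Suc by (auto intro!: bexI[of _ "Suc k"])
    ultimately show ?thesis by (simp only: det if_False mult_zero_right)
  qed
qed

section \<open>The product of the degrees\<close>

definition string_degree :: "bool list \<Rightarrow> nat \<Rightarrow> nat" where
  "string_degree b i = card {j. j < length b \<and> i \<noteq> j \<and> b ! max i j}"

lemma string_degree_snoc:
  "string_degree (b @ [x]) i =
     (if i < length b then string_degree b i + of_bool x else of_bool x * length b)"
  if "i \<le> length b"
proof (cases "i < length b")
  case True
  have "{j. j < length (b @ [x]) \<and> i \<noteq> j \<and> (b @ [x]) ! max i j} =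
      {j. j < length b \<and> i \<noteq> j \<and> b ! max i j} \<union> (if x then {length b} else {})"
    using True by (auto simp: nth_append max_def less_Suc_eq)
  with True show ?thesis
    by (simp add: string_degree_def card_insert_if)
next
  case False
  with that have "i = length b" by simp
  then have "{j. j < length (b @ [x]) \<and> i \<noteq> j \<and> (b @ [x]) ! max i j} =
      (if x then {..<length b} else {})"
    by (auto simp: nth_append max_def)
  with False show ?thesis
    by (simp add: string_degree_def)
qed

text \<open>
  The shift \<open>c\<close> stands for the dominating vertices that are still to be appended; it makes the
  recursion along the string close.
\<close>

definition degree_product :: "bool list \<Rightarrow> real \<Rightarrow> real" where
  "degree_product b c = (\<Prod>i<length b. real (string_degree b i) + c)"

lemma degree_product_Nil [simp]: "degree_product [] c = 1"
  by (simp add: degree_product_def)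

lemma degree_product_snoc:
  "degree_product (b @ [x]) c =
     degree_product b (c + of_bool x) * (of_bool x * real (length b) + c)"
proof -
  have "(\<Prod>i<length b. real (string_degree (b @ [x]) i) + c)
      = (\<Prod>i<length b. real (string_degree b i) + (c + of_bool x))"
    by (intro prod.cong) (auto simp: string_degree_snoc)
  then show ?thesis
    by (simp add: degree_product_def string_degree_snoc)
qed

lemma degree_product_Falses:
  "degree_product (b @ replicate m False) c = degree_product b c * c ^ m"
proof (induction m)
  case (Suc m)
  have "b @ replicate (Suc m) False = (b @ replicate m False) @ [False]"
    by (simp add: replicate_append_same)
  then show ?case
    by (simp only: degree_product_snoc) (simp add: Suc)
qed simp

text \<open>
  Each of the appended vertices is adjacent to all others, so they share the degree
  \<open>length b + m - 1\<close>, and each of them raises all degrees in \<open>b\<close> by one.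
\<close>

lemma degree_product_Trues:
  "degree_product (b @ replicate m True) c =
     degree_product b (c + real m) * (real (length b + m) - 1 + c) ^ m"
proof (induction m arbitrary: c)
  case (Suc m)
  have "b @ replicate (Suc m) True = (b @ replicate m True) @ [True]"
    by (simp add: replicate_append_same)
  then show ?case
    by (simp only: degree_product_snoc) (simp add: Suc algebra_simps)
qed simp

lemma degree_product_block_string:
  "degree_product (block_string k s t) c =
     (\<Prod>i=1..k. (c + real (\<Sum>j=1..k. t j) - real (\<Sum>j=1..i-1. t j)) ^ s i) *
     (\<Prod>i=1..k. (c + real (\<Sum>j=1..k. t j) + real (\<Sum>j=1..i. s j) - 1) ^ t i)"
proof (induction k arbitrary: c)
  case (Suc k)
  have "degree_product (block_string (Suc k) s t) c =
      degree_product (block_string k s t) (c + real (t (Suc k)))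
      * (c + real (t (Suc k))) ^ s (Suc k)
      * (real (length (block_string k s t) + s (Suc k) + t (Suc k)) - 1 + c) ^ t (Suc k)"
    by (simp only: block_string_Suc append_assoc[symmetric] degree_product_Trues
        degree_product_Falses) simp
  then show ?case
    by (simp add: Suc length_block_string algebra_simps)
qed simp

section \<open>From the graph to its string\<close>

lemma threshold_graph_arcs:
  assumes "threshold_graph b G"
  shows "(u, v) \<in> parcs G \<longleftrightarrow>
    u \<in> {1..length b} \<and> v \<in> {1..length b} \<and> u \<noteq> v \<and> b ! (max u v - 1)"
  using assms
proof (induction rule: threshold_graph.induct)
  case single
  show ?case by auto
next
  case (isolated b G)
  then show ?case
    by (auto simp: add_isolated_def nth_append max_def le_Suc_eq)
next
  case (dominating b G)
  note V = threshold_graph_pverts[OF dominating.hyps]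
  show ?case
    using dominating.IH
    by (auto simp: add_dominating_def V nth_append max_def le_Suc_eq)
qed

lemma adjacency_matrix_threshold_graph:
  assumes "threshold_graph b G"
  shows "adjacency_matrix (length b) G = string_matrix b"
  by (intro eq_matI)
    (auto simp: adjacency_matrix_def string_matrix_def threshold_graph_arcs[OF assms])

lemma out_degree_threshold_graph:
  assumes "threshold_graph b G" and "i < length b"
  shows "out_degree (with_proj G) (i + 1) = string_degree b i"
proof -
  have "out_arcs (with_proj G) (i + 1) =
      (\<lambda>j. (i + 1, j + 1)) ` {j. j < length b \<and> i \<noteq> j \<and> b ! max i j}" (is "?L = ?R")
  proof
    show "?L \<subseteq> ?R"
    proof
      fix e assume "e \<in> ?L"
      then obtain v where v: "e = (i + 1, v)" "(i + 1, v) \<in> parcs G"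
        by (cases e) (auto simp: out_arcs_def)
      then show "e \<in> ?R"
        by (cases v) (auto simp: threshold_graph_arcs[OF assms(1)])
    qed
    show "?R \<subseteq> ?L"
      using assms(2) by (auto simp: out_arcs_def threshold_graph_arcs[OF assms(1)])
  qed
  then show ?thesis
    by (simp add: out_degree_def string_degree_def card_image inj_on_def)
qed

lemma det_degree_matrix_threshold_graph:
  assumes "threshold_graph b G"
  shows "det (degree_matrix (length b) G) = degree_product b 0"
proof -
  let ?D = "degree_matrix (length b) G"
  have "det ?D = prod_list (diag_mat ?D)"
    by (rule det_upper_triangular[of _ "length b"]) (auto simp: degree_matrix_def mat_diag_def)
  then show ?thesis
    using out_degree_threshold_graph[OF assms]
    by (simp add: prod_list_diag_prod degree_matrix_def mat_diag_def degree_product_def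
        atLeast0LessThan)
qed

lemma det_normalized_adjacency_matrix:
  assumes "det (degree_matrix n G) \<noteq> 0"
  shows "det (normalized_adjacency_matrix n G) = det (adjacency_matrix n G) / det (degree_matrix n G)"
proof -
  let ?D = "degree_matrix n G"
  have D: "?D \<in> carrier_mat n n" and A: "adjacency_matrix n G \<in> carrier_mat n n"
    by (simp_all add: degree_matrix_def adjacency_matrix_def)
  obtain E where E: "mat_inverse ?D = Some E"
    using mat_inverse(1)[OF D, where b = "()"] det_non_zero_imp_unit[OF D assms, where b = "()"]
    by (cases "mat_inverse ?D") auto
  then have inv: "E * ?D = 1\<^sub>m n" and E_carrier: "E \<in> carrier_mat n n"
    using mat_inverse(2)[OF D E] by auto
  have "det E * det ?D = 1"
    using det_mult[OF E_carrier D] inv by simp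
  then show ?thesis
    using assms by (simp add: normalized_adjacency_matrix_def E det_mult[OF E_carrier A] field_simps)
qed

theorem theorem1p2:
  fixes k n :: nat and s t :: "nat \<Rightarrow> nat" and \<Gamma> :: "nat pair_pre_digraph"
  assumes "k \<ge> 1"
    and "\<And>i. i \<in> {1..k} \<Longrightarrow> s i > 0"
    and "\<And>i. i \<in> {1..k} \<Longrightarrow> t i > 0"
    and "threshold_graph (block_string k s t) \<Gamma>"
    and "connected (with_proj \<Gamma>)"
    and "n = card (pverts \<Gamma>)"
  shows "let S = (\<lambda>i. \<Sum>j=1..i. s j);
             T = (\<lambda>i. \<Sum>j=1..i. t j);
             \<tau> = T k
         in det (normalized_adjacency_matrix n \<Gamma>) =
            (if \<forall>i\<in>{1..k}. s i = 1
             then (-1) ^ \<tau> * (\<Prod>i=1..k. real (t i)) /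
                  ((\<Prod>i=1..k. (real \<tau> - real (T (i - 1)))) *
                   (\<Prod>i=1..k. (real \<tau> + real (S i) - 1) ^ t i))
             else 0)"
proof -
  let ?b = "block_string k s t"
  let ?S = "\<lambda>i. \<Sum>j=1..i. s j" and ?T = "\<lambda>i. \<Sum>j=1..i. t j"
  let ?P = "(\<Prod>i=1..k. (real (?T k) - real (?T (i - 1))) ^ s i) *
    (\<Prod>i=1..k. (real (?T k) + real (?S i) - 1) ^ t i)"
  have n: "n = length ?b"
    using assms(6) threshold_graph_pverts[OF assms(4)] by simp
  have det_D: "det (degree_matrix n \<Gamma>) = ?P"
    using det_degree_matrix_threshold_graph[OF assms(4)] degree_product_block_string[of k s t 0]
    by (simp add: n)
  have "real (?T (i - 1)) < real (?T k)" if i: "i \<in> {1..k}" for i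
  proof -
    have "?T (i - 1) < ?T (i - 1) + t i"
      using assms(3)[OF i] by simp
    also have "\<dots> = ?T i"
      using i by (cases i) simp_all
    also have "\<dots> \<le> ?T k"
      using i by (intro sum_mono2) auto
    finally show ?thesis by (simp only: of_nat_less_iff)
  qed
  moreover have "real (?T k) + real (?S i) - 1 > 0" if i: "i \<in> {1..k}" for i
  proof -
    have "s i \<le> ?S i" "t i \<le> ?T k"
      using i by (auto intro: member_le_sum)
    then have "?T k + ?S i > 1"
      using assms(2,3)[OF i] by linarith
    then show ?thesis by linarith
  qed
  ultimately have "?P > 0"
    by (intro mult_pos_pos prod_pos zero_less_power) (simp_all del: of_nat_sum of_nat_less_iff)
  then have "det (normalized_adjacency_matrix n \<Gamma>) = det (string_matrix ?b) / ?P"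
    using det_normalized_adjacency_matrix[of n \<Gamma>] adjacency_matrix_threshold_graph[OF assms(4)]
    by (simp only: det_D n[symmetric])
  also have "det (string_matrix ?b) =
      (if \<forall>i\<in>{1..k}. s i = 1 then (-1) ^ ?T k * (\<Prod>i=1..k. real (t i)) else 0)"
    by (rule det_string_matrix_block_string[OF assms(2)])
  also have "\<dots> / ?P = (if \<forall>i\<in>{1..k}. s i = 1
       then (-1) ^ ?T k * (\<Prod>i=1..k. real (t i)) /
            ((\<Prod>i=1..k. (real (?T k) - real (?T (i - 1)))) *
             (\<Prod>i=1..k. (real (?T k) + real (?S i) - 1) ^ t i))
       else 0)" (is "_ = (if ?ones then _ / (?Q * _) else 0)")
  proof (cases ?ones)
    case True
    then have "(\<Prod>i=1..k. (real (?T k) - real (?T (i - 1))) ^ s i) = ?Q"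
      by (intro prod.cong) auto
    then show ?thesis by (simp only: if_P[OF True])
  next
    case False
    show ?thesis by (simp only: if_not_P[OF False] div_0)
  qed
  finally show ?thesis
    unfolding Let_def .
qed

end
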